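(* An anti-dendriform algebra $C$ factorizes through two anti-dendriform algebras $A$ and $B$ if and only if there is a matched pair $(A,B,l_{\succ_1},r_{\succ_1},l_{\prec_1},r_{\prec_1},l_{\succ_2},r_{\succ_2},l_{\prec_2},r_{\prec_2})$ of anti-dendriform algebras such that $C\cong A\bowtie B$.
   Context: All vector spaces and algebras are over a field $k$, and all algebras are finite-dimensional. An anti-dendriform algebra $(A,\succ,\prec)$ is a vector space with two bilinear maps $\succ,\prec:A\times A\to A$ such that, writing $x\cdot y=x\succ y+x\prec y$, for all $x,y,z$: $x\succ(y\succ z)=-(x\cdot y)\succ z=-x\prec(y\cdot z)=(x\prec y)\prec z$ and $(x\succ y)\prec z=x\succ(y\prec z)$. $C$ factorizes through $A$ and $B$ if $C$ contains (copies of) $A$ and $B$ as anti-dendriform subalgebras such that $C=A+B$ and $A\cap B=\{0\}$. Let $(A,\succ_1,\prec_1)$ and $(B,\succ_2,\prec_2)$ be anti-dendriform algebras, and let $l_{\succ_1},r_{\succ_1},l_{\prec_1},r_{\prec_1}:A\to\mathrm{End}(B)$ and $l_{\succ_2},r_{\succ_2},l_{\prec_2},r_{\prec_2}:B\to\mathrm{End}(A)$ be linear maps. Then $(A,B,l_{\succ_1},r_{\succ_1},l_{\prec_1},r_{\prec_1},l_{\succ_2},r_{\succ_2},l_{\prec_2},r_{\prec_2})$ is a matched pair of anti-dendriform algebras if the operations $$(x,a)\succ(y,b)=(x\succ_1 y+l_{\succ_2}(a)y+r_{\succ_2}(b)x,\ a\succ_2 b+l_{\succ_1}(x)b+r_{\succ_1}(y)a),$$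 $$(x,a)\prec(y,b)=(x\prec_1 y+l_{\prec_2}(a)y+r_{\prec_2}(b)x,\ a\prec_2 b+l_{\prec_1}(x)b+r_{\prec_1}(y)a)$$ make $A\oplus B$ an anti-dendriform algebra; this algebra is the bicrossed product $A\bowtie B$. *)

theory Defs
  imports "HOL-Analysis.Product_Vector"
begin

text \<open>
  A vector space over the field \<open>'k\<close> is a type \<open>'v\<close> of class \<^class>\<open>ab_group_add\<close> with a scalar
  multiplication satisfying \<^locale>\<open>vector_space\<close>. The record bundles the scalar multiplication with
  the two products.
\<close>

record ('k, 'v) dend_struct =
  smul :: "'k \<Rightarrow> 'v \<Rightarrow> 'v"
  rprod :: "'v \<Rightarrow> 'v \<Rightarrow> 'v" (infixl \<open>\<succ>\<index>\<close> 70)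
  lprod :: "'v \<Rightarrow> 'v \<Rightarrow> 'v" (infixl \<open>\<prec>\<index>\<close> 70)

definition total_prod ::
    "('k, 'v::ab_group_add) dend_struct \<Rightarrow> 'v \<Rightarrow> 'v \<Rightarrow> 'v" (infixl \<open>\<cdot>\<index>\<close> 70)
  where "x \<cdot>\<^bsub>A\<^esub> y = x \<succ>\<^bsub>A\<^esub> y + x \<prec>\<^bsub>A\<^esub> y"

definition bilinear_map ::
    "('k::field \<Rightarrow> 'u::ab_group_add \<Rightarrow> 'u) \<Rightarrow> ('k \<Rightarrow> 'v::ab_group_add \<Rightarrow> 'v) \<Rightarrow>
     ('k \<Rightarrow> 'w::ab_group_add \<Rightarrow> 'w) \<Rightarrow> ('u \<Rightarrow> 'v \<Rightarrow> 'w) \<Rightarrow> bool"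
  where "bilinear_map su sv sw f \<longleftrightarrow>
    (\<forall>x. Vector_Spaces.linear sv sw (f x)) \<and> (\<forall>y. Vector_Spaces.linear su sw (\<lambda>x. f x y))"

locale anti_dendriform_algebra =
  fixes A :: "('k::field, 'v::ab_group_add) dend_struct" (structure)
  assumes finite_dimensional: "\<exists>Basis. finite_dimensional_vector_space (smul A) Basis"
    and bilinear_rprod: "bilinear_map (smul A) (smul A) (smul A) (rprod A)"
    and bilinear_lprod: "bilinear_map (smul A) (smul A) (smul A) (lprod A)"
    and rprod_rprod_eq: "x \<succ> (y \<succ> z) = - ((x \<cdot> y) \<succ> z)"
    and rprod_total_eq: "- ((x \<cdot> y) \<succ> z) = - (x \<prec> (y \<cdot> z))"
    and lprod_total_eq: "- (x \<prec> (y \<cdot> z)) = (x \<prec> y) \<prec> z"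
    and rprod_lprod_assoc: "(x \<succ> y) \<prec> z = x \<succ> (y \<prec> z)"

definition dend_hom ::
    "('k::field, 'v::ab_group_add) dend_struct \<Rightarrow> ('k, 'w::ab_group_add) dend_struct \<Rightarrow>
     ('v \<Rightarrow> 'w) \<Rightarrow> bool"
  where "dend_hom A B f \<longleftrightarrow>
    Vector_Spaces.linear (smul A) (smul B) f \<and>
    (\<forall>x y. f (x \<succ>\<^bsub>A\<^esub> y) = f x \<succ>\<^bsub>B\<^esub> f y) \<and>
    (\<forall>x y. f (x \<prec>\<^bsub>A\<^esub> y) = f x \<prec>\<^bsub>B\<^esub> f y)"

definition dend_isomorphic ::
    "('k::field, 'v::ab_group_add) dend_struct \<Rightarrow> ('k, 'w::ab_group_add) dend_struct \<Rightarrow> bool"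
  where "dend_isomorphic A B \<longleftrightarrow> (\<exists>f. dend_hom A B f \<and> bij f)"

definition dend_subalgebra ::
    "('k::field, 'v::ab_group_add) dend_struct \<Rightarrow> 'v set \<Rightarrow> bool"
  where "dend_subalgebra C S \<longleftrightarrow>
    module.subspace (smul C) S \<and> (\<forall>x\<in>S. \<forall>y\<in>S. x \<succ>\<^bsub>C\<^esub> y \<in> S \<and> x \<prec>\<^bsub>C\<^esub> y \<in> S)"

text \<open>
  \<open>S\<close> is a copy of \<open>A\<close> in \<open>C\<close>: \<open>S\<close> is a subalgebra of \<open>C\<close> which, with the restricted operations, is
  isomorphic to \<open>A\<close>.
\<close>

definition dend_copy ::
    "('k::field, 'v::ab_group_add) dend_struct \<Rightarrow> ('k, 'w::ab_group_add) dend_struct \<Rightarrow>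
     'w set \<Rightarrow> bool"
  where "dend_copy A C S \<longleftrightarrow>
    dend_subalgebra C S \<and> (\<exists>f. dend_hom A C f \<and> bij_betw f UNIV S)"

definition factorizes_through ::
    "('k::field, 'c::ab_group_add) dend_struct \<Rightarrow> ('k, 'a::ab_group_add) dend_struct \<Rightarrow>
     ('k, 'b::ab_group_add) dend_struct \<Rightarrow> bool"
  where "factorizes_through C A B \<longleftrightarrow>
    (\<exists>S T. dend_copy A C S \<and> dend_copy B C T \<and>
       {s + t | s t. s \<in> S \<and> t \<in> T} = UNIV \<and> S \<inter> T = {0})"

text \<open>
  In the next two definitions \<open>ls1\<close>, \<open>rs1\<close>, \<open>lp1\<close>, \<open>rp1\<close> are the actions of \<open>A\<close> on \<open>B\<close> and \<open>ls2\<close>,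
  \<open>rs2\<close>, \<open>lp2\<close>, \<open>rp2\<close> those of \<open>B\<close> on \<open>A\<close> (\<open>l\<close>, \<open>r\<close>: left, right; \<open>s\<close>, \<open>p\<close>: belonging to
  \<open>\<succ>\<close>, \<open>\<prec>\<close>). A linear map from \<open>A\<close> into the endomorphisms of \<open>B\<close> is given in curried form, i.e.
  as a bilinear map from \<open>A\<close> and \<open>B\<close> to \<open>B\<close>.
\<close>

definition bicrossed_product ::
    "('k::field, 'a::ab_group_add) dend_struct \<Rightarrow> ('k, 'b::ab_group_add) dend_struct \<Rightarrow>
     ('a \<Rightarrow> 'b \<Rightarrow> 'b) \<Rightarrow> ('a \<Rightarrow> 'b \<Rightarrow> 'b) \<Rightarrow> ('a \<Rightarrow> 'b \<Rightarrow> 'b) \<Rightarrow> ('a \<Rightarrow> 'b \<Rightarrow> 'b) \<Rightarrow>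
     ('b \<Rightarrow> 'a \<Rightarrow> 'a) \<Rightarrow> ('b \<Rightarrow> 'a \<Rightarrow> 'a) \<Rightarrow> ('b \<Rightarrow> 'a \<Rightarrow> 'a) \<Rightarrow> ('b \<Rightarrow> 'a \<Rightarrow> 'a) \<Rightarrow>
     ('k, 'a \<times> 'b) dend_struct"
  where "bicrossed_product A B ls1 rs1 lp1 rp1 ls2 rs2 lp2 rp2 =
    \<lparr> smul = module_prod.scale (smul A) (smul B),
      rprod = (\<lambda>(x, a) (y, b).
        (x \<succ>\<^bsub>A\<^esub> y + ls2 a y + rs2 b x, a \<succ>\<^bsub>B\<^esub> b + ls1 x b + rs1 y a)),
      lprod = (\<lambda>(x, a) (y, b).
        (x \<prec>\<^bsub>A\<^esub> y + lp2 a y + rp2 b x, a \<prec>\<^bsub>B\<^esub> b + lp1 x b + rp1 y a)) \<rparr>"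

definition matched_pair ::
    "('k::field, 'a::ab_group_add) dend_struct \<Rightarrow> ('k, 'b::ab_group_add) dend_struct \<Rightarrow>
     ('a \<Rightarrow> 'b \<Rightarrow> 'b) \<Rightarrow> ('a \<Rightarrow> 'b \<Rightarrow> 'b) \<Rightarrow> ('a \<Rightarrow> 'b \<Rightarrow> 'b) \<Rightarrow> ('a \<Rightarrow> 'b \<Rightarrow> 'b) \<Rightarrow>
     ('b \<Rightarrow> 'a \<Rightarrow> 'a) \<Rightarrow> ('b \<Rightarrow> 'a \<Rightarrow> 'a) \<Rightarrow> ('b \<Rightarrow> 'a \<Rightarrow> 'a) \<Rightarrow> ('b \<Rightarrow> 'a \<Rightarrow> 'a) \<Rightarrow> bool"
  where "matched_pair A B ls1 rs1 lp1 rp1 ls2 rs2 lp2 rp2 \<longleftrightarrow>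
    anti_dendriform_algebra A \<and> anti_dendriform_algebra B \<and>
    (\<forall>f \<in> {ls1, rs1, lp1, rp1}. bilinear_map (smul A) (smul B) (smul B) f) \<and>
    (\<forall>g \<in> {ls2, rs2, lp2, rp2}. bilinear_map (smul B) (smul A) (smul A) g) \<and>
    anti_dendriform_algebra (bicrossed_product A B ls1 rs1 lp1 rp1 ls2 rs2 lp2 rp2)"

end

theory Submission
  imports Defs
begin

text \<open>
  Suppose that \<open>C\<close> is the direct sum of a copy of \<open>A\<close>, embedded by \<open>f\<close>, and a copy of \<open>B\<close>, embedded
  by \<open>g\<close>. Then \<open>\<phi> (x, a) = f x + g a\<close> is a linear bijection from \<open>A \<times> B\<close> onto \<open>C\<close>, and the two
  mixed products \<open>f x \<succ> g b\<close> and \<open>g a \<succ> f y\<close>, decomposed along this direct sum, have an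
  \<open>A\<close>-component and a \<open>B\<close>-component each: these four components are the actions belonging to
  \<open>\<succ>\<close>, and likewise for \<open>\<prec>\<close>. With this choice the product formula of the bicrossed product is
  the expansion of \<open>(f x + g a) \<succ> (f y + g b)\<close> by bilinearity, so \<open>\<phi>\<close> is multiplicative. The
  anti-dendriform identities and the finite dimension are therefore transported from \<open>C\<close> to the
  bicrossed product (\<open>anti_dendriform_transport\<close>), which is exactly what makes the actions a matched
  pair (\<open>factorization_imp_matched_pair\<close>).

  Conversely, the actions vanish when one argument is \<open>0\<close>, so \<open>x \<mapsto> (x, 0)\<close> and \<open>a \<mapsto> (0, a)\<close> embed
  \<open>A\<close> and \<open>B\<close> as complementary subalgebras of any bicrossed product
  (\<open>bicrossed_product_factorizes\<close>), and a factorization can be carried along an isomorphism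
  (\<open>factorizes_through_isomorphic\<close>).
\<close>

section \<open>Bilinear maps\<close>

lemma bilinear_mapD:
  assumes "bilinear_map su sv sw f"
  shows "vector_space su" and "vector_space sv" and "vector_space sw"
    and "f (x + x') y = f x y + f x' y" and "f x (y + y') = f x y + f x y'"
    and "f (su c x) y = sw c (f x y)" and "f x (sv c y) = sw c (f x y)"
  using assms unfolding bilinear_map_def Vector_Spaces.linear_iff by blast+

lemma bilinear_map_zero:
  assumes "bilinear_map su sv sw f"
  shows "f 0 y = 0" and "f x 0 = 0"
  using bilinear_mapD(4)[OF assms, of 0 0 y] bilinear_mapD(5)[OF assms, of x 0 0] by simp_all

lemma bilinear_map_flip:
  assumes "bilinear_map su sv sw f"
  shows "bilinear_map sv su sw (\<lambda>y x. f x y)"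
  using assms unfolding bilinear_map_def by simp

lemma bilinear_map_compose:
  assumes "bilinear_map su sv sw h"
    and "Vector_Spaces.linear ru su f" and "Vector_Spaces.linear rv sv g"
    and "Vector_Spaces.linear sw rw p"
  shows "bilinear_map ru rv rw (\<lambda>x y. p (h (f x) (g y)))"
  using assms unfolding bilinear_map_def Vector_Spaces.linear_iff by simp

lemma linear_inv_bij:
  assumes lin: "Vector_Spaces.linear s t f" and bij: "bij f"
  shows "Vector_Spaces.linear t s (inv f)"
proof -
  have f_inv: "f (inv f y) = y" for y
    using bij by (simp add: bij_is_surj surj_f_inv_f)
  have inj: "f x = f y \<Longrightarrow> x = y" for x y
    using bij by (simp add: bij_def inj_eq)
  show ?thesis
    using lin unfolding Vector_Spaces.linear_iff by (auto intro!: inj simp: f_inv)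
qed

lemma finite_dimensional_transport:
  assumes lin: "Vector_Spaces.linear s t f" and bij: "bij f"
    and fin: "finite_dimensional_vector_space s Basis"
  shows "finite_dimensional_vector_space t (f ` Basis)"
proof -
  interpret f: Vector_Spaces.linear s t f by (rule lin)
  interpret s: finite_dimensional_vector_space s Basis by (rule fin)
  show ?thesis
  proof unfold_locales
    show "finite (f ` Basis)" using s.finite_Basis by simp
    show "f.vs2.independent (f ` Basis)"
      using f.independent_inj_image s.independent_Basis bij bij_is_inj by blast
    show "f.vs2.span (f ` Basis) = UNIV"
      using f.span_image[of Basis] s.span_Basis bij by (simp add: bij_is_surj)
  qed
qed

section \<open>Homomorphisms and copies\<close>

lemma dend_homD:
  assumes "dend_hom A B f"
  shows "Vector_Spaces.linear (smul A) (smul B) f"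
    and "f (x \<succ>\<^bsub>A\<^esub> y) = f x \<succ>\<^bsub>B\<^esub> f y" and "f (x \<prec>\<^bsub>A\<^esub> y) = f x \<prec>\<^bsub>B\<^esub> f y"
    and "f (x + y) = f x + f y" and "f 0 = 0" and "f (- x) = - f x"
proof -
  show lin: "Vector_Spaces.linear (smul A) (smul B) f"
    and "f (x \<succ>\<^bsub>A\<^esub> y) = f x \<succ>\<^bsub>B\<^esub> f y" and "f (x \<prec>\<^bsub>A\<^esub> y) = f x \<prec>\<^bsub>B\<^esub> f y"
    using assms unfolding dend_hom_def by blast+
  interpret f: Vector_Spaces.linear "smul A" "smul B" f by (rule lin)
  show "f (x + y) = f x + f y" "f 0 = 0" "f (- x) = - f x"
    by (rule f.add f.zero f.neg)+
qed

lemma dend_hom_compose: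
  assumes "dend_hom A B f" and "dend_hom B C g"
  shows "dend_hom A C (g \<circ> f)"
  using assms Vector_Spaces.linear_compose unfolding dend_hom_def by fastforce

lemma dend_hom_inv:
  assumes hom: "dend_hom A B f" and bij: "bij f"
  shows "dend_hom B A (inv f)"
proof -
  have f_inv: "f (inv f y) = y" for y
    using bij by (simp add: bij_is_surj surj_f_inv_f)
  have inj: "f x = f y \<Longrightarrow> x = y" for x y
    using bij by (simp add: bij_def inj_eq)
  have "inv f (x \<succ>\<^bsub>B\<^esub> y) = inv f x \<succ>\<^bsub>A\<^esub> inv f y" for x y
    by (rule inj) (simp add: dend_homD(2)[OF hom] f_inv)
  moreover have "inv f (x \<prec>\<^bsub>B\<^esub> y) = inv f x \<prec>\<^bsub>A\<^esub> inv f y" for x y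
    by (rule inj) (simp add: dend_homD(3)[OF hom] f_inv)
  ultimately show ?thesis
    using linear_inv_bij[OF dend_homD(1)[OF hom] bij] unfolding dend_hom_def by blast
qed

text \<open>
  Each identity holds in \<open>D\<close> because the injective map \<open>f\<close> turns it into the same identity of \<open>C\<close>.
  Bilinearity of the products of \<open>D\<close> comes from writing them as the products of \<open>C\<close> conjugated by \<open>f\<close>.
\<close>

lemma anti_dendriform_transport:
  assumes hom: "dend_hom D C f" and bij: "bij f" and C: "anti_dendriform_algebra C"
  shows "anti_dendriform_algebra D"
proof -
  interpret C: anti_dendriform_algebra C by (rule C)
  have inj: "f x = f y \<Longrightarrow> x = y" for x y
    using bij by (simp add: bij_def inj_eq)
  have inv_f: "inv f (f x) = x" for x
    using bij by (simp add: bij_is_inj)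
  note lin = dend_homD(1)[OF hom]
  note lin_inv = linear_inv_bij[OF lin bij]
  have bij_inv: "bij (inv f)" using bij by (rule bij_imp_bij_inv)
  have prods: "rprod D = (\<lambda>x y. inv f (f x \<succ>\<^bsub>C\<^esub> f y))" "lprod D = (\<lambda>x y. inv f (f x \<prec>\<^bsub>C\<^esub> f y))"
    by (simp_all add: fun_eq_iff inv_f flip: dend_homD(2,3)[OF hom])
  have total: "f (x \<cdot>\<^bsub>D\<^esub> y) = f x \<cdot>\<^bsub>C\<^esub> f y" for x y
    unfolding total_prod_def by (simp add: dend_homD(2-4)[OF hom])
  note push = dend_homD(2,3,6)[OF hom] total
  show ?thesis
  proof
    show "\<exists>Basis. finite_dimensional_vector_space (smul D) Basis"
      using finite_dimensional_transport[OF lin_inv bij_inv] C.finite_dimensional by blast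
    show "bilinear_map (smul D) (smul D) (smul D) (rprod D)"
      unfolding prods by (rule bilinear_map_compose[OF C.bilinear_rprod lin lin lin_inv])
    show "bilinear_map (smul D) (smul D) (smul D) (lprod D)"
      unfolding prods by (rule bilinear_map_compose[OF C.bilinear_lprod lin lin lin_inv])
    fix x y z
    show "x \<succ>\<^bsub>D\<^esub> (y \<succ>\<^bsub>D\<^esub> z) = - ((x \<cdot>\<^bsub>D\<^esub> y) \<succ>\<^bsub>D\<^esub> z)"
      by (rule inj) (simp only: push C.rprod_rprod_eq)
    show "- ((x \<cdot>\<^bsub>D\<^esub> y) \<succ>\<^bsub>D\<^esub> z) = - (x \<prec>\<^bsub>D\<^esub> (y \<cdot>\<^bsub>D\<^esub> z))"
      by (rule inj) (simp only: push C.rprod_total_eq)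
    show "- (x \<prec>\<^bsub>D\<^esub> (y \<cdot>\<^bsub>D\<^esub> z)) = (x \<prec>\<^bsub>D\<^esub> y) \<prec>\<^bsub>D\<^esub> z"
      by (rule inj) (simp only: push C.lprod_total_eq)
    show "(x \<succ>\<^bsub>D\<^esub> y) \<prec>\<^bsub>D\<^esub> z = x \<succ>\<^bsub>D\<^esub> (y \<prec>\<^bsub>D\<^esub> z)"
      by (rule inj) (simp only: push C.rprod_lprod_assoc)
  qed
qed

lemma dend_copy_iff: "dend_copy A C S \<longleftrightarrow> (\<exists>f. dend_hom A C f \<and> inj f \<and> S = range f)"
proof
  assume "dend_copy A C S"
  then show "\<exists>f. dend_hom A C f \<and> inj f \<and> S = range f"
    unfolding dend_copy_def bij_betw_def by blast
next
  assume "\<exists>f. dend_hom A C f \<and> inj f \<and> S = range f"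
  then obtain f where hom: "dend_hom A C f" and f: "inj f" "S = range f" by blast
  interpret f: Vector_Spaces.linear "smul A" "smul C" f by (rule dend_homD(1)[OF hom])
  have "f.vs2.subspace S"
    unfolding f(2) using f.subspace_image f.vs1.subspace_UNIV by blast
  moreover have "\<forall>x\<in>S. \<forall>y\<in>S. x \<succ>\<^bsub>C\<^esub> y \<in> S \<and> x \<prec>\<^bsub>C\<^esub> y \<in> S"
    unfolding f(2) by (auto simp flip: dend_homD(2,3)[OF hom])
  ultimately show "dend_copy A C S"
    unfolding dend_copy_def dend_subalgebra_def bij_betw_def using hom f by blast
qed

text \<open>
  Factorizations are easier to handle through the two embeddings: the conditions on the sum and the
  intersection of their ranges say together that the induced map from the product is bijective.
\<close>

lemma factorizes_through_iff:
  "factorizes_through C A B \<longleftrightarrow>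
    (\<exists>f g. dend_hom A C f \<and> dend_hom B C g \<and> bij (\<lambda>(x, a). f x + g a))"
proof
  assume "factorizes_through C A B"
  then obtain f g where f: "dend_hom A C f" "inj f" and g: "dend_hom B C g" "inj g"
    and sum: "{s + t | s t. s \<in> range f \<and> t \<in> range g} = UNIV" and cap: "range f \<inter> range g = {0}"
    unfolding factorizes_through_def dend_copy_iff by blast
  interpret f: Vector_Spaces.linear "smul A" "smul C" f by (rule dend_homD(1)[OF f(1)])
  interpret g: Vector_Spaces.linear "smul B" "smul C" g by (rule dend_homD(1)[OF g(1)])
  have "surj (\<lambda>(x, a). f x + g a)"
  unfolding surj_def
  proof
    fix c
    have "c \<in> {s + t | s t. s \<in> range f \<and> t \<in> range g}" unfolding sum by simp
    then obtain x a where "c = f x + g a" by blast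
    then show "\<exists>p. c = (case p of (x, a) \<Rightarrow> f x + g a)" by auto
  qed
  moreover have "inj (\<lambda>(x, a). f x + g a)"
  proof (rule injI, clarify)
    fix x a y b assume "f x + g a = f y + g b"
    then have eq: "f (x - y) = g (b - a)" by (simp add: f.diff g.diff algebra_simps)
    then have "f (x - y) \<in> range f \<inter> range g" by (metis IntI rangeI)
    then have "f (x - y) = 0" "g (b - a) = 0" using cap eq by auto
    then have "x - y = 0" "b - a = 0"
      using f(2) g(2) f.inj_iff_eq_0 g.inj_iff_eq_0 by blast+
    then show "x = y \<and> a = b" by simp
  qed
  ultimately show "\<exists>f g. dend_hom A C f \<and> dend_hom B C g \<and> bij (\<lambda>(x, a). f x + g a)"
    using f g unfolding bij_def by blast
next
  assume "\<exists>f g. dend_hom A C f \<and> dend_hom B C g \<and> bij (\<lambda>(x, a). f x + g a)"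
  then obtain f g where f: "dend_hom A C f" and g: "dend_hom B C g"
    and bij: "bij (\<lambda>(x, a). f x + g a)" by blast
  note simps = dend_homD(4-6)[OF f] dend_homD(4-6)[OF g]
  have inj: "x = y \<and> a = b" if "f x + g a = f y + g b" for x y a b
    using injD[OF bij_is_inj[OF bij], of "(x, a)" "(y, b)"] that by simp
  have "inj f" "inj g"
    using inj[of _ 0 _ 0] inj[of 0 _ 0 _] by (auto intro!: injI simp: simps)
  moreover have "{s + t | s t. s \<in> range f \<and> t \<in> range g} = UNIV"
  proof -
    have "\<exists>x a. c = f x + g a" for c
      using surjD[OF bij_is_surj[OF bij], of c] by auto
    then show ?thesis by blast
  qed
  moreover have "range f \<inter> range g = {0}"
  proof -
    have "f x = 0" if "f x = g a" for x a
      using inj[of x 0 0 a] that by (simp add: simps)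
    then show ?thesis using simps(2,5) by (force intro: range_eqI[of _ _ 0])
  qed
  ultimately show "factorizes_through C A B"
    unfolding factorizes_through_def dend_copy_iff using f g by blast
qed

lemma factorizes_through_isomorphic:
  assumes "dend_isomorphic C D" and "factorizes_through D A B"
  shows "factorizes_through C A B"
proof -
  obtain h where h: "dend_hom C D h" "bij h"
    using assms(1) unfolding dend_isomorphic_def by blast
  obtain f g where f: "dend_hom A D f" and g: "dend_hom B D g" and bij: "bij (\<lambda>(x, a). f x + g a)"
    using assms(2) unfolding factorizes_through_iff by blast
  have hom: "dend_hom D C (inv h)" using h by (rule dend_hom_inv)
  have "(\<lambda>(x, a). (inv h \<circ> f) x + (inv h \<circ> g) a) = inv h \<circ> (\<lambda>(x, a). f x + g a)"
    by (auto simp: dend_homD(4)[OF hom])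
  then have "bij (\<lambda>(x, a). (inv h \<circ> f) x + (inv h \<circ> g) a)"
    using bij_comp[OF bij bij_imp_bij_inv[OF h(2)]] by simp
  then show ?thesis
    unfolding factorizes_through_iff
    using dend_hom_compose[OF f hom] dend_hom_compose[OF g hom] by blast
qed

section \<open>Bicrossed products\<close>

lemma vector_space_prod_smul:
  assumes "anti_dendriform_algebra A" and "anti_dendriform_algebra B"
  shows "vector_space_prod (smul A) (smul B)"
  using assms[THEN anti_dendriform_algebra.bilinear_rprod, THEN bilinear_mapD(1)]
  by (simp add: vector_space_prod_def vector_space_pair_def)

lemma bicrossed_product_factorizes:
  fixes A :: "('k::field, 'a::ab_group_add) dend_struct"
    and B :: "('k, 'b::ab_group_add) dend_struct"
  assumes mp: "matched_pair A B ls1 rs1 lp1 rp1 ls2 rs2 lp2 rp2"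
  shows "factorizes_through (bicrossed_product A B ls1 rs1 lp1 rp1 ls2 rs2 lp2 rp2) A B"
    (is "factorizes_through ?D A B")
proof -
  interpret A: anti_dendriform_algebra A using mp by (simp add: matched_pair_def)
  interpret B: anti_dendriform_algebra B using mp by (simp add: matched_pair_def)
  interpret vector_space_prod "smul A" "smul B"
    by (rule vector_space_prod_smul) unfold_locales
  have acts1: "f 0 b = 0" "f x 0 = 0" if "f \<in> {ls1, rs1, lp1, rp1}" for f x b
    using that mp bilinear_map_zero unfolding matched_pair_def by blast+
  have acts2: "f 0 x = 0" "f b 0 = 0" if "f \<in> {ls2, rs2, lp2, rp2}" for f x b
    using that mp bilinear_map_zero unfolding matched_pair_def by blast+
  note zero = acts1 acts2 bilinear_map_zero[OF A.bilinear_rprod] bilinear_map_zero[OF A.bilinear_lprod]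
    bilinear_map_zero[OF B.bilinear_rprod] bilinear_map_zero[OF B.bilinear_lprod]
  have "Vector_Spaces.linear (smul A) scale (\<lambda>x. (x, 0))"
    unfolding Vector_Spaces.linear_iff using vs1.vector_space_axioms p.vector_space_axioms by (simp add: scale_def)
  then have "dend_hom A ?D (\<lambda>x. (x, 0))"
    unfolding dend_hom_def bicrossed_product_def by (simp add: zero)
  moreover have "Vector_Spaces.linear (smul B) scale (\<lambda>a. (0, a))"
    unfolding Vector_Spaces.linear_iff using vs2.vector_space_axioms p.vector_space_axioms by (simp add: scale_def)
  then have "dend_hom B ?D (\<lambda>a. (0, a))"
    unfolding dend_hom_def bicrossed_product_def by (simp add: zero)
  moreover have "bij (\<lambda>(x :: 'a, a :: 'b). (x, 0) + (0, a))"
    by (rule bijI') auto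
  ultimately show ?thesis unfolding factorizes_through_iff by blast
qed

text \<open>
  Each action is a product of \<open>C\<close> composed with the embeddings and with a projection of \<open>C\<close> onto a
  summand, hence bilinear. A left action \<open>l\<close> comes from the mixed product with the acting element on
  the left, a right action \<open>r\<close> from the one with the acting element on the right.
\<close>

lemma factorization_imp_matched_pair:
  assumes A: "anti_dendriform_algebra A" and B: "anti_dendriform_algebra B"
    and C: "anti_dendriform_algebra C" and fact: "factorizes_through C A B"
  shows "\<exists>ls1 rs1 lp1 rp1 ls2 rs2 lp2 rp2.
    matched_pair A B ls1 rs1 lp1 rp1 ls2 rs2 lp2 rp2 \<and>
    dend_isomorphic C (bicrossed_product A B ls1 rs1 lp1 rp1 ls2 rs2 lp2 rp2)"
proof -
  interpret C: anti_dendriform_algebra C by (rule C)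
  interpret vector_space_prod "smul A" "smul B" using A B by (rule vector_space_prod_smul)
  obtain f g where f: "dend_hom A C f" and g: "dend_hom B C g" and bij: "bij (\<lambda>(x, a). f x + g a)"
    using fact unfolding factorizes_through_iff by blast
  define \<phi> where "\<phi> = (\<lambda>(x, a). f x + g a)"
  note lin_f = dend_homD(1)[OF f] and lin_g = dend_homD(1)[OF g]
  have bij: "bij \<phi>" using bij by (simp add: \<phi>_def)
  have lin: "Vector_Spaces.linear scale (smul C) \<phi>"
  proof -
    interpret f: Vector_Spaces.linear "smul A" "smul C" f by (rule lin_f)
    interpret g: Vector_Spaces.linear "smul B" "smul C" g by (rule lin_g)
    show ?thesis
      unfolding Vector_Spaces.linear_iff \<phi>_def
      using p.vector_space_axioms f.vs2.vector_space_axioms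
      by (auto simp: scale_def f.add f.scale g.add g.scale f.vs2.scale_right_distrib add_ac)
  qed
  define P where "P = fst \<circ> inv \<phi>"
  define Q where "Q = snd \<circ> inv \<phi>"
  have lin_P: "Vector_Spaces.linear (smul C) (smul A) P"
    unfolding P_def by (rule Vector_Spaces.linear_compose[OF linear_inv_bij[OF lin bij] linear_fst])
  have lin_Q: "Vector_Spaces.linear (smul C) (smul B) Q"
    unfolding Q_def by (rule Vector_Spaces.linear_compose[OF linear_inv_bij[OF lin bij] linear_snd])
  have decomp: "f (P c) + g (Q c) = c" for c
    using surj_f_inv_f[OF bij_is_surj[OF bij], of c] by (simp add: \<phi>_def P_def Q_def split_beta)
  let ?ls1 = "\<lambda>x b. Q (f x \<succ>\<^bsub>C\<^esub> g b)" and ?rs1 = "\<lambda>y a. Q (g a \<succ>\<^bsub>C\<^esub> f y)"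
  let ?lp1 = "\<lambda>x b. Q (f x \<prec>\<^bsub>C\<^esub> g b)" and ?rp1 = "\<lambda>y a. Q (g a \<prec>\<^bsub>C\<^esub> f y)"
  let ?ls2 = "\<lambda>a y. P (g a \<succ>\<^bsub>C\<^esub> f y)" and ?rs2 = "\<lambda>b x. P (f x \<succ>\<^bsub>C\<^esub> g b)"
  let ?lp2 = "\<lambda>a y. P (g a \<prec>\<^bsub>C\<^esub> f y)" and ?rp2 = "\<lambda>b x. P (f x \<prec>\<^bsub>C\<^esub> g b)"
  let ?D = "bicrossed_product A B ?ls1 ?rs1 ?lp1 ?rp1 ?ls2 ?rs2 ?lp2 ?rp2"
  note flipped = C.bilinear_rprod[THEN bilinear_map_flip] C.bilinear_lprod[THEN bilinear_map_flip]
  have acts1: "\<forall>h \<in> {?ls1, ?rs1, ?lp1, ?rp1}. bilinear_map (smul A) (smul B) (smul B) h"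
    using bilinear_map_compose[OF C.bilinear_rprod lin_f lin_g lin_Q]
      bilinear_map_compose[OF C.bilinear_lprod lin_f lin_g lin_Q]
      flipped[THEN bilinear_map_compose, OF lin_f lin_g lin_Q] by simp
  have acts2: "\<forall>h \<in> {?ls2, ?rs2, ?lp2, ?rp2}. bilinear_map (smul B) (smul A) (smul A) h"
    using bilinear_map_compose[OF C.bilinear_rprod lin_g lin_f lin_P]
      bilinear_map_compose[OF C.bilinear_lprod lin_g lin_f lin_P]
      flipped[THEN bilinear_map_compose, OF lin_g lin_f lin_P] by simp
  have hom: "dend_hom ?D C \<phi>"
  proof -
    \<comment> \<open>The two components of a mixed product recombine to it, by \<open>decomp\<close>.\<close>
    have regroup: "f (x + (P c + P d)) + g (a + (Q c + Q d)) = f x + (c + (d + g a))" for x a c d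
    proof -
      have "f (x + (P c + P d)) + g (a + (Q c + Q d))
          = f x + ((f (P c) + g (Q c)) + ((f (P d) + g (Q d)) + g a))"
        by (simp add: dend_homD(4)[OF f] dend_homD(4)[OF g] add_ac)
      then show ?thesis by (simp only: decomp)
    qed
    have "\<phi> (u \<succ>\<^bsub>?D\<^esub> v) = \<phi> u \<succ>\<^bsub>C\<^esub> \<phi> v" for u v
      by (cases u; cases v) (simp add: bicrossed_product_def \<phi>_def regroup
          bilinear_mapD(4,5)[OF C.bilinear_rprod] dend_homD(2)[OF f] dend_homD(2)[OF g] add_ac)
    moreover have "\<phi> (u \<prec>\<^bsub>?D\<^esub> v) = \<phi> u \<prec>\<^bsub>C\<^esub> \<phi> v" for u v
      by (cases u; cases v) (simp add: bicrossed_product_def \<phi>_def regroup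
          bilinear_mapD(4,5)[OF C.bilinear_lprod] dend_homD(3)[OF f] dend_homD(3)[OF g] add_ac)
    moreover have "smul ?D = scale" by (simp add: bicrossed_product_def)
    ultimately show ?thesis using lin unfolding dend_hom_def by simp
  qed
  have "matched_pair A B ?ls1 ?rs1 ?lp1 ?rp1 ?ls2 ?rs2 ?lp2 ?rp2"
    unfolding matched_pair_def
    using A B acts1 acts2 anti_dendriform_transport[OF hom bij C] by blast
  moreover have "dend_isomorphic C ?D"
    unfolding dend_isomorphic_def using dend_hom_inv[OF hom bij] bij_imp_bij_inv[OF bij] by blast
  ultimately show ?thesis by blast
qed

section \<open>The factorization theorem\<close>

theorem corollary5p3:
  fixes A :: "('k::field, 'a::ab_group_add) dend_struct"
    and B :: "('k, 'b::ab_group_add) dend_struct"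
    and C :: "('k, 'c::ab_group_add) dend_struct"
  assumes "anti_dendriform_algebra A"
    and "anti_dendriform_algebra B"
    and "anti_dendriform_algebra C"
  shows "factorizes_through C A B \<longleftrightarrow>
    (\<exists>ls1 rs1 lp1 rp1 ls2 rs2 lp2 rp2.
       matched_pair A B ls1 rs1 lp1 rp1 ls2 rs2 lp2 rp2 \<and>
       dend_isomorphic C (bicrossed_product A B ls1 rs1 lp1 rp1 ls2 rs2 lp2 rp2))"
  using factorization_imp_matched_pair[OF assms] bicrossed_product_factorizes
    factorizes_through_isomorphic by blast

end
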